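(* Let $n=2$ and let $k_1,k_2\in\mathbb{Z}_{>0}$ be fixed. The maximal number of minimal solutions of a generic regular system $\Sigma=\{P_1,P_2\}$ of two tropical linear differential equations in two unknowns $u_1,u_2$, each of differential order $(k_1,k_2)$, equals $$\frac{(k_1+k_2)(k_1+k_2+1)}{2}.$$ That is, every generic regular system has at most this many minimal solutions, and some generic regular system has exactly this many.
   Context: Let $n\ge 1$ and $k_1,\dots,k_n\in\mathbb{Z}_{>0}$. A system $\Sigma=\{P_1,\dots,P_n\}$ consists of $P_l=\min_{1\le j\le n,\,0\le i\le k_j}\{a_{ijl}+u_j^{(i)}\}$ with $a_{ijl}\in\mathbb{Z}$, $1\le l\le n$. For $S\subseteq\mathbb{Z}_{\ge0}$, $\mathrm{val}_S(i)=\min\{s-i:s\in S,\ s\ge i\}$ ($\infty$ if no such $s$). A tuple $(S_1,\dots,S_n)\ne(\emptyset,\dots,\emptyset)$ of subsets of $\mathbb{Z}_{\ge0}$ is a (nonzero) solution of $\Sigma$ if for every $l$ the minimum $\min_{j,i}\{a_{ijl}+\mathrm{val}_{S_j}(i)\}$ is attained for at least two index pairs $(i,j)$. A minimal solution is a nonzero solution minimal for componentwise inclusion among nonzero solutions. For $j\in[n]$ and $\alpha\ge0$ put $A_{\alpha,j}(P_l)=\min_{0\le i\le\min\{\alpha,k_j\}}\{a_{ijl}+\alpha-i\}$. $P_l$ is regular if: (1) for every $j$ and every $0\le\alpha\le k_j$ the minimum defining $A_{\alpha,j}(P_l)$ is attained exactly once; and (2) the numbers $A_{\alpha,j}(P_l)$,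 $1\le j\le n$, $0\le\alpha<k_j$, are pairwise distinct. $\Sigma$ is regular if all $P_l$ are regular. $\Sigma$ is generic if the sums $\sum_{1\le j\le n}A_{k_{\sigma(j)},\sigma(j)}(P_j)$, $\sigma\in \mathrm{Sym}(n)$, are pairwise distinct, and for all $l_1\ne l_2$, all $j,j_1,j_2\in[n]$ and all $0\le\alpha<k_{j_1}$, $0\le\beta<k_{j_2}$ one has $A_{k_j,j}(P_{l_1})-A_{\alpha,j_1}(P_{l_1})\ne A_{k_j,j}(P_{l_2})-A_{\beta,j_2}(P_{l_2})$. *)

theory Defs
  imports "HOL-Analysis.Analysis" "HOL-Combinatorics.Permutations"
begin

text \<open>
  The unknowns and the equations are both indexed by a finite type \<open>'n\<close>, so that
  $n$ is \<open>CARD('n)\<close>. The polynomial $P = \min_{j,\,i \le k_j} \{a_{ij} + u_j^{(i)}\}$ is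
  represented by its coefficients, \<open>P i j\<close> being $a_{ij}$; only the entries with
  \<open>i \<le> k j\<close> are ever used. A system is the family \<open>\<Sigma>\<close> of its polynomials \<open>\<Sigma> l\<close>.
\<close>

type_synonym 'n tldp = "nat \<Rightarrow> 'n \<Rightarrow> int"

type_synonym 'n tsystem = "'n \<Rightarrow> 'n tldp"

text \<open>The infimum of the empty set in \<^typ>\<open>enat\<close> is \<open>\<infinity>\<close>.\<close>

definition val :: "nat set \<Rightarrow> nat \<Rightarrow> enat" where
  "val S i = (INF s \<in> {s \<in> S. i \<le> s}. enat (s - i))"

definition index_pairs :: "('n \<Rightarrow> nat) \<Rightarrow> (nat \<times> 'n) set" where
  "index_pairs k = {(i, j). i \<le> k j}"

definition term_value :: "'n tldp \<Rightarrow> ('n \<Rightarrow> nat set) \<Rightarrow> nat \<times> 'n \<Rightarrow> ereal" where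
  "term_value P S = (\<lambda>(i, j). ereal (real_of_int (P i j)) + ereal_of_enat (val (S j) i))"

definition min_attained_twice :: "('a \<Rightarrow> ereal) \<Rightarrow> 'a set \<Rightarrow> bool" where
  "min_attained_twice f I \<longleftrightarrow> (\<exists>p\<in>I. \<exists>q\<in>I. p \<noteq> q \<and> f p = Min (f ` I) \<and> f q = Min (f ` I))"

definition nonzero_solution ::
    "('n::finite \<Rightarrow> nat) \<Rightarrow> 'n tsystem \<Rightarrow> ('n \<Rightarrow> nat set) \<Rightarrow> bool" where
  "nonzero_solution k \<Sigma> S \<longleftrightarrow>
     S \<noteq> (\<lambda>j. {}) \<and> (\<forall>l. min_attained_twice (term_value (\<Sigma> l) S) (index_pairs k))"

definition minimal_solution ::
    "('n::finite \<Rightarrow> nat) \<Rightarrow> 'n tsystem \<Rightarrow> ('n \<Rightarrow> nat set) \<Rightarrow> bool" where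
  "minimal_solution k \<Sigma> S \<longleftrightarrow>
     nonzero_solution k \<Sigma> S \<and>
     (\<forall>T. nonzero_solution k \<Sigma> T \<and> (\<forall>j. T j \<subseteq> S j) \<longrightarrow> T = S)"

definition A :: "('n \<Rightarrow> nat) \<Rightarrow> 'n tldp \<Rightarrow> nat \<Rightarrow> 'n \<Rightarrow> int" where
  "A k P \<alpha> j = Min ((\<lambda>i. P i j + int \<alpha> - int i) ` {0..min \<alpha> (k j)})"

definition regular_poly :: "('n \<Rightarrow> nat) \<Rightarrow> 'n tldp \<Rightarrow> bool" where
  "regular_poly k P \<longleftrightarrow>
     (\<forall>j. \<forall>\<alpha>\<le>k j. \<exists>!i. i \<in> {0..min \<alpha> (k j)} \<and> P i j + int \<alpha> - int i = A k P \<alpha> j) \<and>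
     inj_on (\<lambda>(\<alpha>, j). A k P \<alpha> j) {(\<alpha>, j). \<alpha> < k j}"

definition regular_system :: "('n \<Rightarrow> nat) \<Rightarrow> 'n tsystem \<Rightarrow> bool" where
  "regular_system k \<Sigma> \<longleftrightarrow> (\<forall>l. regular_poly k (\<Sigma> l))"

definition generic_system :: "('n::finite \<Rightarrow> nat) \<Rightarrow> 'n tsystem \<Rightarrow> bool" where
  "generic_system k \<Sigma> \<longleftrightarrow>
     inj_on (\<lambda>\<sigma>. \<Sum>j\<in>UNIV. A k (\<Sigma> j) (k (\<sigma> j)) (\<sigma> j)) {\<sigma>. \<sigma> permutes UNIV} \<and>
     (\<forall>l1 l2. l1 \<noteq> l2 \<longrightarrow>
       (\<forall>j j1 j2. \<forall>\<alpha><k j1. \<forall>\<beta><k j2.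
          A k (\<Sigma> l1) (k j) j - A k (\<Sigma> l1) \<alpha> j1 \<noteq> A k (\<Sigma> l2) (k j) j - A k (\<Sigma> l2) \<beta> j2))"

end

theory Submission
  imports Defs
begin

text \<open>
  A tuple \<open>S\<close> is regarded as the set of points $(s, j)$ with $s \in S_j$, and the point
  $(s, j)$ gets the value $f_l(s, j) = A_{s,j}(P_l)$, where $A_{s,j} = A_{k_j,j} + (s - k_j)$
  for $s \ge k_j$. Since $\mathrm{val}_{S_j}(i)$ is the least $s - i$ with $s \in S_j$,
  $s \ge i$, the minimum of $P_l$ at \<open>S\<close> is $\min f_l$ over the points of \<open>S\<close>, and
  regularity makes it attained as often in the one sense as in the other
  (\<open>regular_min_attained_twice_iff\<close>). So \<open>S\<close> is a nonzero solution iff every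
  $f_l$ has a tie at its minimum over the points of \<open>S\<close>.

  Call $(s, j)$ low if $s < k_j$ and high otherwise; for $n = 2$ there are
  $K = k_1 + k_2$ low points. Sort the points into three classes: low, high in the first
  column, high in the second column. As each $f_l$ is injective on the low points and on the
  high points of a column, a tie joins two different classes. By genericity
  the ties of $f_1$ and of $f_2$ cannot join the same two classes
  (\<open>ties_class_pair_neq\<close>), hence together they meet all three
  (\<open>ties_meet_class\<close>). A minimal solution consists of the two ties only, so it is
  $L \cup \{(s, 1), (t, 2)\}$ with high $(s, 1)$, $(t, 2)$ and a set $L$ of one or two low
  points (\<open>minimal_points_form\<close>). Given $L$, each equation confines $(s, t)$ to a
  tropical line in the plane, and by genericity the two lines are in general position and meet
  at most once (\<open>tropical_lines_meet_once\<close>). Therefore the number of minimal solutions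
  is at most the number of possible $L$, which is $K + {K \choose 2} = K(K+1)/2$.

  For the bound to be attained, each $L$ has to occur. This is achieved by letting $f_1$ and
  $f_2$ order the low points in opposite ways, with all low values of $f_1$ above those of
  $f_2$, and by taking $f_2(k_2, 2)$ very negative: then the minimum of $f_1$ is attained by
  the $f_1$-least point of $L$ together with $(s, 1)$, that of $f_2$ by the $f_2$-least point
  of $L$ together with $(t, 2)$, and none of these points can be dropped
  (\<open>extremal_system_minimal_points\<close>).
\<close>

section \<open>Solutions of regular systems as sets of points\<close>

text \<open>
  The graph of a tuple: the pairs $(s, j)$ with $s \in S_j$.
\<close>

definition points :: "('n \<Rightarrow> nat set) \<Rightarrow> (nat \<times> 'n) set" where
  "points S = {(s, j). s \<in> S j}"

text \<open>
  The value of a polynomial at a point; unlike in the definition of regularity, $s$ may exceed $k_j$.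
\<close>

definition pval :: "('n \<Rightarrow> nat) \<Rightarrow> 'n tldp \<Rightarrow> nat \<times> 'n \<Rightarrow> int" where
  "pval k P = (\<lambda>(s, j). A k P s j)"

text \<open>
  The distinct points \<open>x\<close> and \<open>y\<close> both minimize \<open>f\<close> over \<open>X\<close>.
\<close>

definition tie :: "('a \<Rightarrow> int) \<Rightarrow> 'a set \<Rightarrow> 'a \<Rightarrow> 'a \<Rightarrow> bool" where
  "tie f X x y \<longleftrightarrow> x \<in> X \<and> y \<in> X \<and> x \<noteq> y \<and> f x = f y \<and> (\<forall>z\<in>X. f x \<le> f z)"

lemma points_subset_iff: "points S \<subseteq> points T \<longleftrightarrow> (\<forall>j. S j \<subseteq> T j)"
  by (auto simp: points_def)

lemma points_eq_iff: "points S = points T \<longleftrightarrow> S = T"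
  by (auto simp: points_def fun_eq_iff set_eq_iff)

lemma ex_points: "\<exists>S. points S = X"
  by (rule exI[of _ "\<lambda>j. {s. (s, j) \<in> X}"]) (auto simp: points_def)

lemma points_empty_iff: "points S = {} \<longleftrightarrow> S = (\<lambda>j. {})"
  by (auto simp: points_def fun_eq_iff)

lemma A_le:
  assumes "i \<le> \<alpha>" "i \<le> k j"
  shows "A k P \<alpha> j \<le> P i j + int \<alpha> - int i"
  unfolding A_def by (rule Min_le) (use assms in auto)

lemma A_attained: "\<exists>i\<le>\<alpha>. i \<le> k j \<and> A k P \<alpha> j = P i j + int \<alpha> - int i"
proof -
  have "A k P \<alpha> j \<in> (\<lambda>i. P i j + int \<alpha> - int i) ` {0..min \<alpha> (k j)}"
    unfolding A_def by (rule Min_in) auto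
  then show ?thesis by auto
qed

lemma A_beyond_order:
  assumes "k j \<le> s"
  shows "A k P s j = A k P (k j) j + int s - int (k j)"
proof (rule antisym)
  obtain i where "i \<le> k j" "A k P (k j) j = P i j + int (k j) - int i"
    using A_attained[of "k j" k j P] by auto
  then show "A k P s j \<le> A k P (k j) j + int s - int (k j)"
    using A_le[of i s k j P] assms by auto
next
  obtain i where "i \<le> k j" "A k P s j = P i j + int s - int i"
    using A_attained[of s k j P] by auto
  then show "A k P (k j) j + int s - int (k j) \<le> A k P s j"
    using A_le[of i "k j" k j P] by auto
qed

text \<open>
  Regularity asks for unique minimizers only up to $s = k_j$, but for larger $s$ the competing terms
  are those at $k_j$, all shifted by $s - k_j$.
\<close>

lemma regular_poly_argmin_unique:
  assumes reg: "regular_poly k P"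
    and i: "i \<le> s" "i \<le> k j" "P i j + int s - int i = A k P s j"
    and i': "i' \<le> s" "i' \<le> k j" "P i' j + int s - int i' = A k P s j"
  shows "i = i'"
proof -
  define \<alpha> where "\<alpha> = min s (k j)"
  have le: "\<alpha> \<le> k j" "i \<le> \<alpha>" "i' \<le> \<alpha>" using i i' by (auto simp: \<alpha>_def)
  have sh: "A k P s j = A k P \<alpha> j + int s - int \<alpha>"
    using A_beyond_order[of k j s P] by (auto simp: \<alpha>_def min_def)
  have "\<exists>!i. i \<in> {0..min \<alpha> (k j)} \<and> P i j + int \<alpha> - int i = A k P \<alpha> j"
    using reg le(1) unfolding regular_poly_def by blast
  moreover have "i \<in> {0..min \<alpha> (k j)} \<and> P i j + int \<alpha> - int i = A k P \<alpha> j"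
    "i' \<in> {0..min \<alpha> (k j)} \<and> P i' j + int \<alpha> - int i' = A k P \<alpha> j"
    using i i' le sh by auto
  ultimately show ?thesis by blast
qed

lemma val_le: "s \<in> S \<Longrightarrow> i \<le> s \<Longrightarrow> val S i \<le> enat (s - i)"
  unfolding val_def by (rule INF_lower) auto

lemma val_attained:
  assumes "val S i \<noteq> \<infinity>"
  shows "\<exists>s\<in>S. i \<le> s \<and> val S i = enat (s - i)"
proof -
  let ?V = "(\<lambda>s. enat (s - i)) ` {s \<in> S. i \<le> s}"
  have "?V \<noteq> {}"
  proof
    assume "?V = {}"
    then show False using assms by (simp only: val_def Inf_empty top_enat_def)
  qed
  then have "Inf ?V \<in> ?V" by (auto intro: wellorder_InfI)
  then show ?thesis by (auto simp: val_def)
qed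

lemma term_value_le:
  assumes "s \<in> S j" "i \<le> s"
  shows "term_value P S (i, j) \<le> ereal (of_int (P i j + int s - int i))"
proof -
  have "ereal_of_enat (val (S j) i) \<le> ereal_of_enat (enat (s - i))"
    using val_le[of s "S j" i] assms by (simp only: ereal_of_enat_le_iff)
  then have "term_value P S (i, j) \<le> ereal (of_int (P i j)) + ereal_of_enat (enat (s - i))"
    unfolding term_value_def prod.case by (rule add_left_mono)
  also have "\<dots> = ereal (of_int (P i j + int s - int i))"
    using assms by (simp add: of_nat_diff)
  finally show ?thesis .
qed

lemma term_value_attained:
  assumes "term_value P S (i, j) \<noteq> \<infinity>"
  shows "\<exists>s\<in>S j. i \<le> s \<and> term_value P S (i, j) = ereal (of_int (P i j + int s - int i))"
proof -
  have "val (S j) i \<noteq> \<infinity>" using assms by (auto simp: term_value_def)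
  then obtain s where "s \<in> S j" "i \<le> s" "val (S j) i = enat (s - i)"
    using val_attained by blast
  then show ?thesis
    by (intro bexI[of _ s]) (auto simp: term_value_def of_nat_diff algebra_simps)
qed

lemma finite_index_pairs: "finite (index_pairs (k :: 'n::finite \<Rightarrow> nat))"
proof -
  have "index_pairs k \<subseteq> {..Max (range k)} \<times> UNIV"
  proof
    fix p assume "p \<in> index_pairs k"
    then have "fst p \<le> k (snd p)" by (auto simp: index_pairs_def)
    also have "\<dots> \<le> Max (range k)" by (rule Max_ge) auto
    finally show "p \<in> {..Max (range k)} \<times> UNIV" by (cases p) auto
  qed
  then show ?thesis by (rule finite_subset) auto
qed

text \<open>
  The two ways of counting agree because of an injection in each direction. A term $(i, j)$ that attains
  the minimum has $\mathrm{val}_{S_j}(i) = s - i$ for some $s \in S_j$, and then $(s, j)$ has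
  the same value; two such terms with the same $s$ would contradict regularity. Conversely, a minimal
  point $(s, j)$ is sent to the $i$ that attains $A_{s,j}$; two points of the same column with the
  same $i$ have different values.
\<close>

lemma regular_min_attained_twice_iff:
  fixes k :: "'n::finite \<Rightarrow> nat"
  assumes reg: "regular_poly k P" and ne: "points S \<noteq> {}"
  shows "min_attained_twice (term_value P S) (index_pairs k) \<longleftrightarrow>
    (\<exists>x y. tie (pval k P) (points S) x y)"
proof -
  let ?T = "term_value P S" and ?I = "index_pairs k" and ?f = "pval k P"
  have below: "\<exists>i. (i, j) \<in> ?I \<and> i \<le> s \<and> P i j + int s - int i = ?f (s, j)
      \<and> ?T (i, j) \<le> ereal (of_int (?f (s, j)))" if "(s, j) \<in> points S" for s j
  proof -
    obtain i where i: "i \<le> s" "i \<le> k j" "A k P s j = P i j + int s - int i"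
      using A_attained[of s k j P] by blast
    have "?T (i, j) \<le> ereal (of_int (P i j + int s - int i))"
      using that i(1) by (intro term_value_le) (auto simp: points_def)
    then show ?thesis using i by (intro exI[of _ i]) (auto simp: index_pairs_def pval_def)
  qed
  have above: "\<exists>s. (s, j) \<in> points S \<and> i \<le> s \<and>
      ?T (i, j) = ereal (of_int (P i j + int s - int i)) \<and> ?f (s, j) \<le> P i j + int s - int i"
    if p: "(i, j) \<in> ?I" "?T (i, j) \<noteq> \<infinity>" for i j
  proof -
    obtain s where "s \<in> S j" "i \<le> s" "?T (i, j) = ereal (of_int (P i j + int s - int i))"
      using term_value_attained[OF p(2)] by blast
    then show ?thesis using A_le[of i s k j P] p(1)
      by (intro exI[of _ s]) (auto simp: points_def index_pairs_def pval_def)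
  qed
  have fin: "finite (?T ` ?I)" using finite_index_pairs by blast
  show ?thesis
  proof
    assume "min_attained_twice ?T ?I"
    then obtain i j i' j' where pq: "(i, j) \<in> ?I" "(i', j') \<in> ?I" "(i, j) \<noteq> (i', j')"
      "?T (i, j) = Min (?T ` ?I)" "?T (i', j') = Min (?T ` ?I)"
      unfolding min_attained_twice_def by auto
    have low: "Min (?T ` ?I) \<le> ereal (of_int (?f z))" if z_in: "z \<in> points S" for z
    proof -
      obtain s j where z: "z = (s, j)" by (cases z)
      then obtain i where "(i, j) \<in> ?I" "?T (i, j) \<le> ereal (of_int (?f z))"
        using below[of s j] z_in by auto
      then show ?thesis using Min_le[OF fin, of "?T (i, j)"] by fastforce
    qed
    obtain z where "z \<in> points S" using ne by blast
    then have "Min (?T ` ?I) \<noteq> \<infinity>" using low[of z] by auto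
    then have finite_terms: "?T (i, j) \<noteq> \<infinity>" "?T (i', j') \<noteq> \<infinity>" using pq by simp_all
    obtain s where s: "(s, j) \<in> points S" "i \<le> s"
        "?T (i, j) = ereal (of_int (P i j + int s - int i))" "?f (s, j) \<le> P i j + int s - int i"
      using above[OF pq(1) finite_terms(1)] by blast
    obtain s' where s': "(s', j') \<in> points S" "i' \<le> s'"
        "?T (i', j') = ereal (of_int (P i' j' + int s' - int i'))" "?f (s', j') \<le> P i' j' + int s' - int i'"
      using above[OF pq(2) finite_terms(2)] by blast
    have "P i j + int s - int i \<le> ?f (s, j)" "P i' j' + int s' - int i' \<le> ?f (s', j')"
      using low[OF s(1)] low[OF s'(1)] pq(4,5) unfolding s(3) s'(3)
      by (metis ereal_less_eq(3) of_int_le_iff)+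
    then have eq: "?f (s, j) = P i j + int s - int i" "?f (s', j') = P i' j' + int s' - int i'"
      using s(4) s'(4) by simp_all
    have min: "ereal (of_int (?f (s, j))) = Min (?T ` ?I)"
      "ereal (of_int (?f (s', j'))) = Min (?T ` ?I)"
      unfolding eq using s(3) s'(3) pq(4,5) by simp_all
    have "(s, j) \<noteq> (s', j')"
      using regular_poly_argmin_unique[OF reg, of i s j i'] pq(1-3) s s' eq
      by (auto simp: index_pairs_def pval_def)
    moreover have "?f (s, j) = ?f (s', j')" using min by (metis ereal.inject of_int_eq_iff)
    moreover have "?f (s, j) \<le> ?f z" if "z \<in> points S" for z
      using low[OF that] min(1)[symmetric] by simp
    ultimately show "\<exists>x y. tie ?f (points S) x y"
      unfolding tie_def using s(1) s'(1) by blast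
  next
    assume "\<exists>x y. tie ?f (points S) x y"
    then obtain s j s' j' where t: "tie ?f (points S) (s, j) (s', j')" by auto
    define m where "m = ?f (s, j)"
    have m': "?f (s', j') = m" using t by (simp add: tie_def m_def)
    obtain i where i: "(i, j) \<in> ?I" "i \<le> s" "P i j + int s - int i = m"
      "?T (i, j) \<le> ereal (of_int m)"
      using below[of s j] t by (auto simp: tie_def m_def)
    obtain i' where i': "(i', j') \<in> ?I" "i' \<le> s'" "P i' j' + int s' - int i' = m"
      "?T (i', j') \<le> ereal (of_int m)"
      using below[of s' j'] t m' by (auto simp: tie_def)
    have ge: "ereal (of_int m) \<le> ?T p" if p: "p \<in> ?I" for p
    proof (cases "?T p = \<infinity>")
      case False
      obtain a b where ab: "p = (a, b)" by (cases p)
      obtain r where "(r, b) \<in> points S" "?T p = ereal (of_int (P a b + int r - int a))"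
          "?f (r, b) \<le> P a b + int r - int a"
        using above[of a b] p False ab by auto
      moreover have "m \<le> ?f (r, b)" using t calculation(1) by (auto simp: tie_def m_def)
      ultimately have "m \<le> P a b + int r - int a" by linarith
      then show ?thesis using \<open>?T p = _\<close> by (metis ereal_less_eq(3) of_int_le_iff)
    qed simp
    have Ti: "?T (i, j) = ereal (of_int m)" "?T (i', j') = ereal (of_int m)"
      using ge[OF i(1)] ge[OF i'(1)] i(4) i'(4) by auto
    have M: "Min (?T ` ?I) = ereal (of_int m)"
      by (rule Min_eqI[OF fin]) (use ge Ti i(1) in \<open>auto intro: rev_image_eqI\<close>)
    have "(i, j) \<noteq> (i', j')" using t i(3) i'(3) by (auto simp: tie_def)
    then show "min_attained_twice ?T ?I"
      unfolding min_attained_twice_def M using Ti i(1) i'(1) by blast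
  qed
qed

text \<open>
  Nonzero solutions as sets of points. A tie needs a point, so the empty set is excluded.
\<close>

definition point_solution :: "('n \<Rightarrow> nat) \<Rightarrow> 'n tsystem \<Rightarrow> (nat \<times> 'n) set \<Rightarrow> bool" where
  "point_solution k \<Sigma> X \<longleftrightarrow> (\<forall>l. \<exists>x y. tie (pval k (\<Sigma> l)) X x y)"

lemma nonzero_solution_iff_point_solution:
  fixes k :: "'n::finite \<Rightarrow> nat"
  assumes "regular_system k \<Sigma>"
  shows "nonzero_solution k \<Sigma> S \<longleftrightarrow> point_solution k \<Sigma> (points S)"
proof (cases "points S = {}")
  case True
  moreover have "\<not> point_solution k \<Sigma> {}" by (simp add: point_solution_def tie_def)
  ultimately show ?thesis
    unfolding True using True by (simp add: nonzero_solution_def points_empty_iff)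
next
  case False
  then show ?thesis
    using assms regular_min_attained_twice_iff[OF _ False, of k]
    by (simp add: nonzero_solution_def point_solution_def points_empty_iff regular_system_def)
qed

lemma minimal_solution_iff_point_solution:
  fixes k :: "'n::finite \<Rightarrow> nat"
  assumes "regular_system k \<Sigma>"
  shows "minimal_solution k \<Sigma> S \<longleftrightarrow> point_solution k \<Sigma> (points S) \<and>
    (\<forall>Y\<subseteq>points S. point_solution k \<Sigma> Y \<longrightarrow> Y = points S)"
  unfolding minimal_solution_def nonzero_solution_iff_point_solution[OF assms]
  by (metis ex_points points_eq_iff points_subset_iff)


section \<open>Two unknowns: the position of the ties\<close>

text \<open>
  The points $(s, j)$ with $s < k_j$, whose values under a regular polynomial are pairwise distinct;
  the remaining points are called high.
\<close>

definition low :: "('n \<Rightarrow> nat) \<Rightarrow> (nat \<times> 'n) set" where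
  "low k = {(s, j). s < k j}"

text \<open>
  The class of a point: \<open>None\<close> for low points, \<open>Some j\<close> for high points of column \<open>j\<close>.
\<close>

definition point_class :: "('n \<Rightarrow> nat) \<Rightarrow> nat \<times> 'n \<Rightarrow> 'n option" where
  "point_class k = (\<lambda>(s, j). if s < k j then None else Some j)"

lemma point_class_None: "point_class k x = None \<longleftrightarrow> x \<in> low k"
  by (auto simp: point_class_def low_def split: if_splits)

lemma point_class_Some: "point_class k x = Some j \<longleftrightarrow> snd x = j \<and> k j \<le> fst x"
  by (cases x) (auto simp: point_class_def)

lemma pval_high: "k j \<le> s \<Longrightarrow> pval k P (s, j) = A k P (k j) j + int s - int (k j)"
  by (simp add: pval_def A_beyond_order[of k j s])

lemma inj_on_pval_low: "regular_poly k P \<Longrightarrow> inj_on (pval k P) (low k)"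
  by (simp add: regular_poly_def pval_def low_def)

lemma tie_class_neq:
  assumes "regular_poly k P" "tie (pval k P) X x y"
  shows "point_class k x \<noteq> point_class k y"
proof
  assume eq: "point_class k x = point_class k y"
  have t: "pval k P x = pval k P y" "x \<noteq> y" using assms(2) by (auto simp: tie_def)
  show False
  proof (cases "point_class k x")
    case None
    then have "x \<in> low k" "y \<in> low k" using eq by (simp_all flip: point_class_None)
    then show ?thesis using inj_on_pval_low[OF assms(1)] t by (auto dest: inj_onD)
  next
    case (Some j)
    then have "point_class k y = Some j" using eq by simp
    with Some have "x = (fst x, j)" "y = (fst y, j)" "k j \<le> fst x" "k j \<le> fst y"
      by (simp_all add: point_class_Some prod_eq_iff)
    then show ?thesis using t pval_high[of k j "fst x" P] pval_high[of k j "fst y" P] by auto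
  qed
qed

text \<open>
  On the high points of a column all polynomials increase in the same way, so any of them
  selects the least high point of $X$ in that column.
\<close>

lemma ties_same_high_class_eq:
  assumes "tie (pval k P) X x y" "tie (pval k Q) X x' y'"
    and "z \<in> {x, y}" "z' \<in> {x', y'}" "point_class k z = Some j" "point_class k z' = Some j"
  shows "z = z'"
proof -
  have "z = (fst z, j)" "z' = (fst z', j)" "k j \<le> fst z" "k j \<le> fst z'"
    using assms(5,6) by (auto simp: point_class_Some prod_eq_iff)
  moreover have "pval k P z \<le> pval k P z'" "pval k Q z' \<le> pval k Q z"
    using assms(1-4) by (auto simp: tie_def)
  ultimately have "fst z = fst z'"
    using pval_high[of k j "fst z" P] pval_high[of k j "fst z'" P]
      pval_high[of k j "fst z" Q] pval_high[of k j "fst z'" Q] by auto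
  then show ?thesis using \<open>z = _\<close> \<open>z' = _\<close> by metis
qed

lemma one_neq_two: "(1 :: 2) \<noteq> 2"
  by simp

text \<open>
  The first genericity condition, for the identity and the transposition.
\<close>

lemma generic_corner_neq:
  fixes k :: "2 \<Rightarrow> nat"
  assumes gen: "generic_system k \<Sigma>"
  shows "A k (\<Sigma> 1) (k 1) 1 + A k (\<Sigma> 2) (k 2) 2 \<noteq> A k (\<Sigma> 1) (k 2) 2 + A k (\<Sigma> 2) (k 1) 1"
proof
  assume eq: "A k (\<Sigma> 1) (k 1) 1 + A k (\<Sigma> 2) (k 2) 2 = A k (\<Sigma> 1) (k 2) 2 + A k (\<Sigma> 2) (k 1) 1"
  let ?\<tau> = "Transposition.transpose (1 :: 2) 2"
  have inj: "inj_on (\<lambda>\<sigma>. \<Sum>j\<in>UNIV. A k (\<Sigma> j) (k (\<sigma> j)) (\<sigma> j)) {\<sigma>. \<sigma> permutes UNIV}"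
    using gen by (simp only: generic_system_def)
  have "id = ?\<tau>"
  proof (rule inj_onD[OF inj])
    show "(\<Sum>j\<in>UNIV. A k (\<Sigma> j) (k (id j)) (id j)) = (\<Sum>j\<in>UNIV. A k (\<Sigma> j) (k (?\<tau> j)) (?\<tau> j))"
      unfolding sum_2 using eq by (simp only: id_apply transpose_apply_first transpose_apply_second)
    show "id \<in> {\<sigma>. \<sigma> permutes (UNIV :: 2 set)}" by (simp add: permutes_id)
    show "?\<tau> \<in> {\<sigma>. \<sigma> permutes UNIV}" by (simp add: permutes_swap_id)
  qed
  then have "id (1 :: 2) = ?\<tau> 1" by (rule fun_cong)
  then show False using one_neq_two by (simp only: id_apply transpose_apply_first)
qed

text \<open>
  The second genericity condition: a high point that ties with a low point for one polynomial does not
  tie with any low point for another one.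
\<close>

lemma generic_low_high_neq:
  assumes gen: "generic_system k \<Sigma>" and "l \<noteq> l'"
    and "x \<in> low k" "x' \<in> low k" "k j \<le> s"
    and "pval k (\<Sigma> l) x = pval k (\<Sigma> l) (s, j)"
  shows "pval k (\<Sigma> l') x' \<noteq> pval k (\<Sigma> l') (s, j)"
proof -
  obtain \<alpha> a \<beta> b where "x = (\<alpha>, a)" "x' = (\<beta>, b)" "\<alpha> < k a" "\<beta> < k b"
    using assms(3,4) by (auto simp: low_def)
  moreover from this have
    "A k (\<Sigma> l) (k j) j - A k (\<Sigma> l) \<alpha> a \<noteq> A k (\<Sigma> l') (k j) j - A k (\<Sigma> l') \<beta> b"
    using gen \<open>l \<noteq> l'\<close> unfolding generic_system_def by blast
  ultimately show ?thesis
    using assms(6) pval_high[of k j s, OF assms(5)] by (auto simp: pval_def)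
qed

lemma ties_class_pair_neq:
  fixes k :: "2 \<Rightarrow> nat"
  assumes gen: "generic_system k \<Sigma>" and reg: "regular_system k \<Sigma>"
    and t1: "tie (pval k (\<Sigma> 1)) X x y" and t2: "tie (pval k (\<Sigma> 2)) X x' y'"
    and cx: "point_class k x = point_class k x'" and cy: "point_class k y = point_class k y'"
  shows False
proof -
  have "point_class k x \<noteq> point_class k y"
    using tie_class_neq[OF _ t1] reg by (simp add: regular_system_def)
  then consider j where "point_class k x = None" "point_class k y = Some j"
    | j where "point_class k x = Some j" "point_class k y = None"
    | j j' where "point_class k x = Some j" "point_class k y = Some j'" "j \<noteq> j'"
    by (cases "point_class k x"; cases "point_class k y") auto
  then show False
  proof cases
    case (1 j)
    have "y = y'" using ties_same_high_class_eq[OF t1 t2, of y y' j] 1 cy by simp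
    moreover have "x \<in> low k" "x' \<in> low k" using 1 cx by (simp_all flip: point_class_None)
    moreover have "y = (fst y, j)" "k j \<le> fst y" using 1 by (auto simp: point_class_Some prod_eq_iff)
    ultimately show False
      using generic_low_high_neq[OF gen one_neq_two, of x x' j "fst y"] t1 t2
      by (auto simp: tie_def)
  next
    case (2 j)
    have "x = x'" using ties_same_high_class_eq[OF t1 t2, of x x' j] 2 cx by simp
    moreover have "y \<in> low k" "y' \<in> low k" using 2 cy by (simp_all flip: point_class_None)
    moreover have "x = (fst x, j)" "k j \<le> fst x" using 2 by (auto simp: point_class_Some prod_eq_iff)
    ultimately show False
      using generic_low_high_neq[OF gen one_neq_two, of y y' j "fst x"] t1 t2
      by (auto simp: tie_def)
  next
    case (3 j j')
    have eq: "x = x'" "y = y'"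
      using ties_same_high_class_eq[OF t1 t2, of x x' j]
        ties_same_high_class_eq[OF t1 t2, of y y' j'] 3 cx cy by simp_all
    have xy: "x = (fst x, j)" "k j \<le> fst x" "y = (fst y, j')" "k j' \<le> fst y"
      using 3 by (auto simp: point_class_Some prod_eq_iff)
    have "pval k (\<Sigma> 1) (fst x, j) = pval k (\<Sigma> 1) (fst y, j')"
      "pval k (\<Sigma> 2) (fst x, j) = pval k (\<Sigma> 2) (fst y, j')"
      using t1 t2 eq xy(1,3) by (simp_all add: tie_def)
    then have "A k (\<Sigma> 1) (k j) j + A k (\<Sigma> 2) (k j') j' = A k (\<Sigma> 1) (k j') j' + A k (\<Sigma> 2) (k j) j"
      using pval_high[of k j "fst x"] pval_high[of k j' "fst y"] xy(2,4) by auto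
    moreover have "j = 1 \<and> j' = 2 \<or> j = 2 \<and> j' = 1"
      using exhaust_2[of j] exhaust_2[of j'] \<open>j \<noteq> j'\<close> by metis
    ultimately show False using generic_corner_neq[OF gen] by auto
  qed
qed

lemma tie_sym: "tie f X x y \<Longrightarrow> tie f X y x"
  by (auto simp: tie_def)

text \<open>
  Two distinct pairs of classes cover all three classes.
\<close>

lemma ties_meet_class:
  fixes k :: "2 \<Rightarrow> nat"
  assumes gen: "generic_system k \<Sigma>" and reg: "regular_system k \<Sigma>"
    and t1: "tie (pval k (\<Sigma> 1)) X x y" and t2: "tie (pval k (\<Sigma> 2)) X x' y'"
  shows "\<exists>z\<in>{x, y, x', y'}. point_class k z = c"
proof -
  have "point_class k x \<noteq> point_class k y" "point_class k x' \<noteq> point_class k y'"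
    using tie_class_neq[OF _ t1] tie_class_neq[OF _ t2] reg by (simp_all add: regular_system_def)
  moreover have "\<not> (point_class k x = point_class k x' \<and> point_class k y = point_class k y')"
    "\<not> (point_class k x = point_class k y' \<and> point_class k y = point_class k x')"
    using ties_class_pair_neq[OF gen reg t1 t2] ties_class_pair_neq[OF gen reg t1 tie_sym[OF t2]]
    by blast+
  moreover have "c \<in> {a, b, a', b'}"
    if "a \<noteq> b" "a' \<noteq> b'" "\<not> (a = a' \<and> b = b')" "\<not> (a = b' \<and> b = a')" for a b a' b' :: "2 option"
  proof (rule ccontr)
    assume c: "c \<notin> {a, b, a', b'}"
    \<comment> \<open>Only one pair of classes avoids \<open>c\<close>.\<close>
    have "card (UNIV - {c}) = 2" by (simp add: card_Diff_singleton card_UNIV_option)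
    moreover have "card {a, b} = 2" "card {a', b'} = 2" using that by simp_all
    moreover have "{a, b} \<subseteq> UNIV - {c}" "{a', b'} \<subseteq> UNIV - {c}" using c by auto
    ultimately have "{a, b} = UNIV - {c}" "{a', b'} = UNIV - {c}"
      by (metis card_subset_eq finite)+
    then have "{a, b} = {a', b'}" by simp
    then show False using that by (auto simp: doubleton_eq_iff)
  qed
  ultimately have "c \<in> {point_class k x, point_class k y, point_class k x', point_class k y'}"
    by blast
  then show ?thesis by auto
qed



section \<open>The low points determine a minimal solution\<close>

text \<open>
  Minimal solutions as sets of points.
\<close>

definition minimal_points :: "('n \<Rightarrow> nat) \<Rightarrow> 'n tsystem \<Rightarrow> (nat \<times> 'n) set \<Rightarrow> bool" where
  "minimal_points k \<Sigma> X \<longleftrightarrow>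
     point_solution k \<Sigma> X \<and> (\<forall>Y\<subseteq>X. point_solution k \<Sigma> Y \<longrightarrow> Y = X)"

lemma point_solution_2:
  fixes k :: "2 \<Rightarrow> nat"
  shows "point_solution k \<Sigma> X \<longleftrightarrow>
    (\<exists>x y. tie (pval k (\<Sigma> 1)) X x y) \<and> (\<exists>x y. tie (pval k (\<Sigma> 2)) X x y)"
  unfolding point_solution_def by (rule forall_2)

lemma tie_subset: "tie f X x y \<Longrightarrow> Y \<subseteq> X \<Longrightarrow> x \<in> Y \<Longrightarrow> y \<in> Y \<Longrightarrow> tie f Y x y"
  by (auto simp: tie_def)

lemma minimal_points_form:
  fixes k :: "2 \<Rightarrow> nat"
  assumes gen: "generic_system k \<Sigma>" and reg: "regular_system k \<Sigma>"
    and min: "minimal_points k \<Sigma> X"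
  obtains s t where "k 1 \<le> s" "k 2 \<le> t" "X = (X \<inter> low k) \<union> {(s, 1), (t, 2)}"
    "X \<inter> low k \<noteq> {}" "card (X \<inter> low k) \<le> 2"
proof -
  obtain x y x' y' where t1: "tie (pval k (\<Sigma> 1)) X x y" and t2: "tie (pval k (\<Sigma> 2)) X x' y'"
    using min unfolding minimal_points_def point_solution_2 by blast
  have sub: "{x, y, x', y'} \<subseteq> X" using t1 t2 by (auto simp: tie_def)
  then have "point_solution k \<Sigma> {x, y, x', y'}"
    unfolding point_solution_2 using tie_subset[OF t1 sub] tie_subset[OF t2 sub] by blast
  then have X: "X = {x, y, x', y'}" using min sub unfolding minimal_points_def by blast
  have cls: "\<exists>z\<in>X. point_class k z = c" for c
    using ties_meet_class[OF gen reg t1 t2] X by blast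
  have uniq: "z = z'" if zz: "z \<in> X" "z' \<in> X" "point_class k z = Some j" "point_class k z' = Some j"
    for z z' j
  proof -
    have ne: "point_class k x \<noteq> point_class k y" "point_class k x' \<noteq> point_class k y'"
      using tie_class_neq[OF _ t1] tie_class_neq[OF _ t2] reg by (simp_all add: regular_system_def)
    consider "{z, z'} \<subseteq> {x, y}" | "{z, z'} \<subseteq> {x', y'}"
      | "z \<in> {x, y}" "z' \<in> {x', y'}" | "z' \<in> {x, y}" "z \<in> {x', y'}"
      using zz(1,2) unfolding X by auto
    then show ?thesis
    proof cases
      case 3
      then show ?thesis using ties_same_high_class_eq[OF t1 t2] zz by metis
    next
      case 4
      then show ?thesis using ties_same_high_class_eq[OF t1 t2] zz by metis
    qed (use ne zz in auto)
  qed
  obtain u where u: "u \<in> X" "point_class k u = Some 1" using cls by blast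
  obtain v where v: "v \<in> X" "point_class k v = Some 2" using cls by blast
  define s t where "s = fst u" and "t = fst v"
  have us: "u = (s, 1)" "k 1 \<le> s" and vt: "v = (t, 2)" "k 2 \<le> t"
    using u v by (auto simp: point_class_Some prod_eq_iff s_def t_def)
  have form: "X = (X \<inter> low k) \<union> {(s, 1), (t, 2)}"
  proof
    show "X \<subseteq> (X \<inter> low k) \<union> {(s, 1), (t, 2)}"
    proof
      fix z assume z: "z \<in> X"
      show "z \<in> (X \<inter> low k) \<union> {(s, 1), (t, 2)}"
      proof (cases "point_class k z")
        case None
        then show ?thesis using z by (simp add: point_class_None)
      next
        case (Some j)
        then show ?thesis
          using exhaust_2[of j] uniq[OF z u(1) _ u(2)] uniq[OF z v(1) _ v(2)] us vt by auto
      qed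
    qed
  qed (use u v us vt in auto)
  have disj: "(X \<inter> low k) \<inter> {(s, 1), (t, 2)} = {}" using us vt by (auto simp: low_def)
  have "finite X" "card X \<le> 4" unfolding X by (simp_all add: card_insert_if)
  moreover have "card X = card (X \<inter> low k) + card {(s, 1 :: 2), (t, 2)}"
    using disj \<open>finite X\<close> by (subst form, subst card_Un_disjoint) auto
  moreover have "card {(s, 1 :: 2), (t, 2)} = 2" by simp
  ultimately have "card (X \<inter> low k) \<le> 2" by linarith
  moreover have "X \<inter> low k \<noteq> {}" using cls[of None] by (auto simp: point_class_None)
  ultimately show ?thesis using that us vt form by blast
qed

text \<open>
  The minimum of three numbers is attained at least twice. For fixed \<open>m\<close>, $a_0$, $b_0$, the pairs
  $(p, q)$ with \<open>min_twice3 m (a0 + p) (b0 + q)\<close> form a tropical line with apex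
  $(m - a_0, m - b_0)$.
\<close>

definition min_twice3 :: "int \<Rightarrow> int \<Rightarrow> int \<Rightarrow> bool" where
  "min_twice3 m a b \<longleftrightarrow> (m = a \<and> m \<le> b) \<or> (m = b \<and> m \<le> a) \<or> (a = b \<and> a \<le> m)"

lemma tie_min_twice3:
  assumes t: "tie f (L \<union> {u, v}) x y" and L: "finite L" "L \<noteq> {}" "inj_on f L"
  shows "min_twice3 (Min (f ` L)) (f u) (f v)"
proof -
  have min: "f x = f y" "x \<noteq> y" "x \<in> L \<union> {u, v}" "y \<in> L \<union> {u, v}" "f x \<le> f u" "f x \<le> f v"
    using t by (auto simp: tie_def)
  have "f x \<le> Min (f ` L)"
    using L t by (auto simp: tie_def)
  moreover have "Min (f ` L) \<le> f z" if "z \<in> L" for z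
    using L that by simp
  moreover have "\<not> (x \<in> L \<and> y \<in> L)"
    using L(3) min(1,2) by (auto dest: inj_onD)
  ultimately show ?thesis
    using min unfolding min_twice3_def by fastforce
qed

text \<open>
  The first three conditions say that the apexes of the two lines do not lie on a common vertical,
  horizontal or diagonal line, so that no ray of one line overlaps a parallel ray of the other.
\<close>

lemma tropical_lines_meet_once:
  fixes a1 a2 b1 b2 m1 m2 p q p' q' :: int
  assumes "a1 - m1 \<noteq> a2 - m2" "b1 - m1 \<noteq> b2 - m2" "a1 + b2 \<noteq> b1 + a2"
    and "min_twice3 m1 (a1 + p) (b1 + q)" "min_twice3 m2 (a2 + p) (b2 + q)"
    and "min_twice3 m1 (a1 + p') (b1 + q')" "min_twice3 m2 (a2 + p') (b2 + q')"
  shows "p = p' \<and> q = q'"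
  using assms(4-7) unfolding min_twice3_def
  by (elim disjE conjE) (use assms(1-3) in linarith)+

lemma finite_low: "finite (low (k :: 2 \<Rightarrow> nat))" and card_low: "card (low k) = k 1 + k 2"
proof -
  have eq: "low k = {..<k 1} \<times> {1} \<union> {..<k 2} \<times> {2}"
  proof (rule set_eqI)
    fix z :: "nat \<times> 2"
    obtain s j where z: "z = (s, j)" by (cases z)
    show "z \<in> low k \<longleftrightarrow> z \<in> {..<k 1} \<times> {1} \<union> {..<k 2} \<times> {2}"
      unfolding z using exhaust_2[of j] by (auto simp: low_def)
  qed
  show "finite (low k)" unfolding eq by simp
  show "card (low k) = k 1 + k 2" unfolding eq by (subst card_Un_disjoint) (auto simp: card_cartesian_product)
qed

text \<open>
  The low part $L$ of a minimal solution determines the two high points, since these have to satisfy both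
  line equations whose data are the minima of $f_1$ and $f_2$ over $L$.
\<close>

lemma minimal_points_inj:
  fixes k :: "2 \<Rightarrow> nat"
  assumes gen: "generic_system k \<Sigma>" and reg: "regular_system k \<Sigma>"
  shows "inj_on (\<lambda>X. X \<inter> low k) {X. minimal_points k \<Sigma> X}"
proof (rule inj_onI, clarify)
  fix X X'
  assume min: "minimal_points k \<Sigma> X" and min': "minimal_points k \<Sigma> X'"
    and eq: "X \<inter> low k = X' \<inter> low k"
  define L where "L = X \<inter> low k"
  obtain s t where st: "k 1 \<le> s" "k 2 \<le> t" and X: "X = L \<union> {(s, 1), (t, 2)}" and ne: "L \<noteq> {}"
    using minimal_points_form[OF gen reg min] unfolding L_def by metis
  obtain s' t' where st': "k 1 \<le> s'" "k 2 \<le> t'" and X': "X' = L \<union> {(s', 1), (t', 2)}"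
    using minimal_points_form[OF gen reg min'] unfolding L_def eq by metis
  have fin: "finite L" using finite_low by (simp add: L_def)
  define m where "m l = Min (pval k (\<Sigma> l) ` L)" for l
  have line: "min_twice3 (m l) (pval k (\<Sigma> l) (s, 1)) (pval k (\<Sigma> l) (t, 2))"
    "min_twice3 (m l) (pval k (\<Sigma> l) (s', 1)) (pval k (\<Sigma> l) (t', 2))" for l
  proof -
    have inj: "inj_on (pval k (\<Sigma> l)) L"
      using inj_on_pval_low[of k "\<Sigma> l"] reg
      by (auto simp: regular_system_def L_def intro: inj_on_subset)
    show "min_twice3 (m l) (pval k (\<Sigma> l) (s, 1)) (pval k (\<Sigma> l) (t, 2))"
      using min tie_min_twice3[OF _ fin ne inj] unfolding m_def X minimal_points_def point_solution_def
      by blast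
    show "min_twice3 (m l) (pval k (\<Sigma> l) (s', 1)) (pval k (\<Sigma> l) (t', 2))"
      using min' tie_min_twice3[OF _ fin ne inj] unfolding m_def X' minimal_points_def point_solution_def
      by blast
  qed
  have apex: "A k (\<Sigma> 1) (k j) j - m 1 \<noteq> A k (\<Sigma> 2) (k j) j - m 2" for j
  proof -
    have "m l \<in> pval k (\<Sigma> l) ` L" for l
      unfolding m_def using fin ne by (intro Min_in) auto
    then obtain x y where xy: "x \<in> L" "m 1 = pval k (\<Sigma> 1) x" "y \<in> L" "m 2 = pval k (\<Sigma> 2) y"
      by blast
    moreover obtain \<alpha> a \<beta> b where "x = (\<alpha>, a)" "y = (\<beta>, b)" "\<alpha> < k a" "\<beta> < k b"
      using xy by (auto simp: L_def low_def)
    ultimately show ?thesis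
      using gen one_neq_two unfolding generic_system_def pval_def by auto
  qed
  have "int s - int (k 1) = int s' - int (k 1) \<and> int t - int (k 2) = int t' - int (k 2)"
    by (rule tropical_lines_meet_once[OF apex apex generic_corner_neq[OF gen]])
      (use line[of 1] line[of 2] st st' in \<open>simp_all only: pval_high add_diff_eq\<close>)
  then show "X = X'" unfolding X X' by simp
qed

text \<open>
  The possible sets of low points of a minimal solution: one or two low points.
\<close>

definition pair_family :: "('n \<Rightarrow> nat) \<Rightarrow> (nat \<times> 'n) set set" where
  "pair_family k = {L. L \<subseteq> low k \<and> L \<noteq> {} \<and> card L \<le> 2}"

lemma card_pair_family:
  fixes k :: "2 \<Rightarrow> nat"
  shows "finite (pair_family k)" "card (pair_family k) = (k 1 + k 2) * (k 1 + k 2 + 1) div 2"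
proof -
  have fin: "finite {L. L \<subseteq> low k \<and> card L = n}" for n
    using finite_low[of k] by simp
  have "pair_family k = {L. L \<subseteq> low k \<and> card L = 1} \<union> {L. L \<subseteq> low k \<and> card L = 2}"
  proof -
    have "L \<noteq> {} \<and> card L \<le> 2 \<longleftrightarrow> card L = 1 \<or> card L = 2" if "L \<subseteq> low k" for L
    proof -
      have "card L = 0 \<longleftrightarrow> L = {}"
        using finite_subset[OF that finite_low] by simp
      then show ?thesis by auto
    qed
    then show ?thesis unfolding pair_family_def by auto
  qed
  moreover have "card ({L. L \<subseteq> low k \<and> card L = 1} \<union> {L. L \<subseteq> low k \<and> card L = 2}) =
      (card (low k) choose 1) + (card (low k) choose 2)"
    using fin n_subsets[OF finite_low, of k] by (subst card_Un_disjoint) auto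
  moreover have "(n choose 1) + (n choose 2) = n * (n + 1) div 2" for n :: nat
  proof -
    have "(n choose 1) + (n choose 2) = Suc n choose 2" by (simp add: numeral_2_eq_2)
    then show ?thesis using choose_two[of "Suc n"] by (simp add: mult.commute)
  qed
  ultimately show "finite (pair_family k)"
    "card (pair_family k) = (k 1 + k 2) * (k 1 + k 2 + 1) div 2"
    using fin by (simp_all only: card_low finite_Un)
qed

lemma minimal_points_low_in_pair_family:
  fixes k :: "2 \<Rightarrow> nat"
  assumes "generic_system k \<Sigma>" "regular_system k \<Sigma>"
  shows "(\<lambda>X. X \<inter> low k) ` {X. minimal_points k \<Sigma> X} \<subseteq> pair_family k"
  using minimal_points_form[OF assms] by (auto simp: pair_family_def)

lemma minimal_solutions_bij:
  fixes k :: "'n::finite \<Rightarrow> nat"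
  assumes "regular_system k \<Sigma>"
  shows "bij_betw points {S. minimal_solution k \<Sigma> S} {X. minimal_points k \<Sigma> X}"
proof (rule bij_betw_imageI)
  show "inj_on points {S. minimal_solution k \<Sigma> S}"
    by (simp add: inj_on_def points_eq_iff)
  show "points ` {S. minimal_solution k \<Sigma> S} = {X. minimal_points k \<Sigma> X}"
  proof (rule set_eqI)
    fix X :: "(nat \<times> 'n) set"
    obtain S where S: "points S = X" using ex_points by blast
    show "X \<in> points ` {S. minimal_solution k \<Sigma> S} \<longleftrightarrow> X \<in> {X. minimal_points k \<Sigma> X}"
      unfolding S[symmetric] minimal_points_def
      by (auto simp: minimal_solution_iff_point_solution[OF assms])
  qed
qed

section \<open>A system with the maximal number of minimal solutions\<close>

text \<open>
  The position of the low point $(s, j)$ when the low points of the first column are listed first.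
\<close>

definition low_rank :: "(2 \<Rightarrow> nat) \<Rightarrow> nat \<Rightarrow> 2 \<Rightarrow> int" where
  "low_rank k s j = int s + (if j = 1 then 0 else int (k 1))"

text \<open>
  The value $A_{k_j,j}(P_l)$ in the extremal system. The only nonzero one separates the two columns:
  $f_2(k_2, 2) = -3K$, where $3K$ exceeds every difference between the value of a low point under $f_1$
  and that of a low point under $f_2$.
\<close>

definition top_value :: "(2 \<Rightarrow> nat) \<Rightarrow> 2 \<Rightarrow> 2 \<Rightarrow> int" where
  "top_value k l j = (if l = 2 \<and> j = 2 then - 3 * int (k 1 + k 2) else 0)"

text \<open>
  The coefficients are chosen to give $A_{\alpha,j}(P_1) = 2K - r$ and $A_{\alpha,j}(P_2) = r$ at the
  low point of rank $r$, which \<open>extremal_system_A\<close> confirms. The coefficients of $P_1$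
  decrease in $i$, so $A_{\alpha,j}(P_1)$ is attained at $i = \alpha$; those of $P_2$ with
  $0 < i < k_j$ are too large to matter, so $A_{\alpha,j}(P_2)$ is attained at $i = 0$ and grows
  by one with each $\alpha$. At $\alpha = k_j$ both are attained at $i = k_j$.
\<close>

definition extremal_system :: "(2 \<Rightarrow> nat) \<Rightarrow> 2 tsystem" where
  "extremal_system k l i j =
    (if i = k j then top_value k l j
     else if l = 1 then 2 * int (k 1 + k 2) - low_rank k i j
     else if i = 0 then low_rank k 0 j else low_rank k i j + 1)"

lemma low_rank_bounds:
  assumes "s < k j"
  shows "0 \<le> low_rank k s j" "low_rank k s j < int (k 1 + k 2)"
  using assms exhaust_2[of j] by (auto simp: low_rank_def)

lemma low_rank_eq:
  assumes "s < k j" "s' < k j'" "low_rank k s j = low_rank k s' j'"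
  shows "s = s' \<and> j = j'"
  using assms exhaust_2[of j] exhaust_2[of j'] by (auto simp: low_rank_def)

lemma A_eqI:
  assumes i0: "i0 \<le> \<alpha>" "i0 \<le> k j"
    and less: "\<And>i. i \<le> \<alpha> \<Longrightarrow> i \<le> k j \<Longrightarrow> i \<noteq> i0 \<Longrightarrow> P i0 j - int i0 < P i j - int i"
  shows "A k P \<alpha> j = P i0 j + int \<alpha> - int i0"
    and "\<exists>!i. i \<in> {0..min \<alpha> (k j)} \<and> P i j + int \<alpha> - int i = A k P \<alpha> j"
proof -
  obtain i where i: "i \<le> \<alpha>" "i \<le> k j" "A k P \<alpha> j = P i j + int \<alpha> - int i"
    using A_attained[of \<alpha> k j P] by blast
  have "i = i0" using A_le[of i0 \<alpha> k j P] i0 i less[OF i(1,2)] by (cases "i = i0") auto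
  then show eq: "A k P \<alpha> j = P i0 j + int \<alpha> - int i0" using i by simp
  show "\<exists>!i. i \<in> {0..min \<alpha> (k j)} \<and> P i j + int \<alpha> - int i = A k P \<alpha> j"
  proof (rule ex1I[of _ i0])
    show "i0 \<in> {0..min \<alpha> (k j)} \<and> P i0 j + int \<alpha> - int i0 = A k P \<alpha> j"
      using i0 eq by simp
    fix i assume i: "i \<in> {0..min \<alpha> (k j)} \<and> P i j + int \<alpha> - int i = A k P \<alpha> j"
    then show "i = i0" using eq less[of i] by (cases "i = i0") auto
  qed
qed

lemma two_cases: "(j :: 2) \<noteq> 1 \<longleftrightarrow> j = 2"
  using exhaust_2[of j] by auto

text \<open>
  The index $i$ at which $A_{\alpha,j}(P_l)$ is attained in the extremal system.
\<close>

definition argmin_index :: "(2 \<Rightarrow> nat) \<Rightarrow> 2 \<Rightarrow> nat \<Rightarrow> 2 \<Rightarrow> nat" where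
  "argmin_index k l \<alpha> j = (if l = 1 \<or> \<alpha> = k j then \<alpha> else 0)"

lemma extremal_system_argmin:
  assumes pos: "\<And>j. k j > 0" and "\<alpha> \<le> k j" "i \<le> \<alpha>" "i \<noteq> argmin_index k l \<alpha> j"
  shows "extremal_system k l (argmin_index k l \<alpha> j) j - int (argmin_index k l \<alpha> j)
    < extremal_system k l i j - int i"
proof -
  define c where "c = low_rank k 0 j"
  have shift: "low_rank k i' j = c + int i'" for i' by (simp add: c_def low_rank_def)
  have bounds: "0 \<le> c" "c + int (k j) \<le> int (k 1 + k 2)"
    using exhaust_2[of j] by (auto simp: c_def low_rank_def)
  have top: "top_value k l' j \<le> 0" for l' by (simp add: top_value_def)
  consider "\<alpha> = k j" | "\<alpha> < k j" "l = 1" | "\<alpha> < k j" "l \<noteq> 1" using assms(2) by linarith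
  then show ?thesis
  proof cases
    case 1
    then have "argmin_index k l \<alpha> j = k j" "i < k j"
      using assms(3,4) by (auto simp: argmin_index_def)
    then show ?thesis using bounds top[of 1] top[of l] by (auto simp add: extremal_system_def shift)
  next
    case 2
    then have "argmin_index k l \<alpha> j = \<alpha>" "i < \<alpha>"
      using assms(3,4) by (auto simp: argmin_index_def)
    then show ?thesis using 2 by (simp add: extremal_system_def shift)
  next
    case 3
    then have "argmin_index k l \<alpha> j = 0" "0 < i" "i < k j"
      using assms(3,4) by (auto simp: argmin_index_def)
    then show ?thesis using 3 pos[of j] by (simp add: extremal_system_def shift)
  qed
qed

lemma extremal_system_A:
  assumes pos: "\<And>j. k j > 0"
  shows "A k (extremal_system k l) (k j) j = top_value k l j"
    and "s < k j \<Longrightarrow> A k (extremal_system k l) s j =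
      (if l = 1 then 2 * int (k 1 + k 2) - low_rank k s j else low_rank k s j)"
  using A_eqI(1)[of "argmin_index k l (k j) j" "k j" k j "extremal_system k l"]
    A_eqI(1)[of "argmin_index k l s j" s k j "extremal_system k l"]
    extremal_system_argmin[of k, OF pos, of "k j" j _ l] extremal_system_argmin[of k, OF pos, of s j _ l]
  by (auto simp: argmin_index_def extremal_system_def low_rank_def split: if_splits)

lemma extremal_system_regular:
  assumes pos: "\<And>j. k j > 0"
  shows "regular_system k (extremal_system k)"
  unfolding regular_system_def regular_poly_def
proof (intro allI impI conjI)
  fix l \<alpha> j assume "\<alpha> \<le> k j"
  moreover have "argmin_index k l \<alpha> j \<le> \<alpha>" by (simp add: argmin_index_def)
  ultimately show "\<exists>!i. i \<in> {0..min \<alpha> (k j)} \<and>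
      extremal_system k l i j + int \<alpha> - int i = A k (extremal_system k l) \<alpha> j"
    using extremal_system_argmin[of k, OF pos, of \<alpha> j _ l]
    by (intro A_eqI(2)[of "argmin_index k l \<alpha> j"]) auto
next
  fix l
  show "inj_on (\<lambda>(\<alpha>, j). A k (extremal_system k l) \<alpha> j) {(\<alpha>, j). \<alpha> < k j}"
  proof (rule inj_onI, clarify)
    fix s j s' j'
    assume "s < k j" "s' < k j'" "A k (extremal_system k l) s j = A k (extremal_system k l) s' j'"
    then show "s = s' \<and> j = j'"
      using low_rank_eq[of s k j s' j'] by (simp add: extremal_system_A[of k, OF pos] split: if_splits)
  qed
qed

lemma extremal_system_generic:
  assumes pos: "\<And>j. k j > 0"
  shows "generic_system k (extremal_system k)"
  unfolding generic_system_def
proof (intro conjI allI impI)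
  show "inj_on (\<lambda>\<sigma>. \<Sum>j\<in>UNIV. A k (extremal_system k j) (k (\<sigma> j)) (\<sigma> j)) {\<sigma>. \<sigma> permutes UNIV}"
  proof (rule inj_onI, clarify)
    fix \<sigma> \<tau> :: "2 \<Rightarrow> 2"
    assume perm: "\<sigma> permutes UNIV" "\<tau> permutes UNIV"
      and "(\<Sum>j\<in>UNIV. A k (extremal_system k j) (k (\<sigma> j)) (\<sigma> j)) =
        (\<Sum>j\<in>UNIV. A k (extremal_system k j) (k (\<tau> j)) (\<tau> j))"
    then have "\<sigma> 2 = 2 \<longleftrightarrow> \<tau> 2 = 2"
      using pos[of 1] by (simp only: extremal_system_A[of k, OF pos] sum_2) (auto simp: top_value_def split: if_splits)
    then have "\<sigma> 2 = \<tau> 2" using two_cases by metis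
    moreover have "\<sigma> 1 \<noteq> \<sigma> 2" "\<tau> 1 \<noteq> \<tau> 2"
      using perm permutes_inj one_neq_two by (metis injD)+
    ultimately have "\<sigma> 1 = \<tau> 1" using two_cases by metis
    then show "\<sigma> = \<tau>" using \<open>\<sigma> 2 = \<tau> 2\<close> by (simp add: fun_eq_iff forall_2)
  qed
  fix l l' j j1 j2 :: 2 and \<alpha> \<beta>
  assume "l \<noteq> l'" "\<alpha> < k j1" "\<beta> < k j2"
  then show "A k (extremal_system k l) (k j) j - A k (extremal_system k l) \<alpha> j1 \<noteq>
      A k (extremal_system k l') (k j) j - A k (extremal_system k l') \<beta> j2"
    using low_rank_bounds[of \<alpha> k j1] low_rank_bounds[of \<beta> k j2] two_cases[of l] two_cases[of l']
    by (auto simp: extremal_system_A[of k, OF pos] top_value_def)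
qed

lemma extremal_system_minimal_points:
  assumes pos: "\<And>j. k j > 0" and L: "L \<in> pair_family k"
  shows "\<exists>X. minimal_points k (extremal_system k) X \<and> X \<inter> low k = L"
proof -
  let ?f = "\<lambda>l. pval k (extremal_system k l)" and ?K = "int (k 1 + k 2)"
  define r where "r = (\<lambda>(s, j). low_rank k s j)"
  have LL: "L \<subseteq> low k" "L \<noteq> {}" "card L \<le> 2" using L by (auto simp: pair_family_def)
  have fin: "finite L" using LL finite_low finite_subset by blast
  \<comment> \<open>The point of greatest rank minimizes the first polynomial over \<open>L\<close>, that of least rank the
    second; for a singleton the two coincide.\<close>
  obtain x where x: "x \<in> L" "\<forall>z\<in>L. r z \<le> r x"
    using ex_is_arg_min_if_finite[OF fin LL(2), of "\<lambda>z. - r z"]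
    unfolding is_arg_min_linorder neg_le_iff_le by blast
  obtain y where y: "y \<in> L" "\<forall>z\<in>L. r y \<le> r z"
    using ex_is_arg_min_if_finite[OF fin LL(2), of r] unfolding is_arg_min_linorder by blast
  have r_inj: "u = v" if "u \<in> low k" "v \<in> low k" "r u = r v" for u v
    using that low_rank_eq by (auto simp: low_def r_def)
  have r_bd: "0 \<le> r u" "r u < ?K" if "u \<in> low k" for u
    using that low_rank_bounds by (auto simp: low_def r_def)
  have low_xy: "x \<in> low k" "y \<in> low k" using x y LL by auto
  have Lxy: "L = {x, y}"
  proof (cases "x = y")
    case True
    have "z = x" if z: "z \<in> L" for z
    proof (rule r_inj)
      show "z \<in> low k" "x \<in> low k" using z LL(1) low_xy(1) by blast+
      show "r z = r x" using bspec[OF x(2) z] bspec[OF y(2) z] True by simp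
    qed
    then show ?thesis using x(1) y(1) by blast
  next
    case False
    then have "card {x, y} = 2" by simp
    then show ?thesis using x y LL fin card_seteq[of L "{x, y}"] by simp
  qed
  \<comment> \<open>The high points are placed so that \<open>(s, 1)\<close> ties with \<open>x\<close> for the first polynomial and
    \<open>(t, 2)\<close> with \<open>y\<close> for the second.\<close>
  define s t where "s = k 1 + nat (2 * ?K - r x)" and "t = k 2 + nat (r y + 3 * ?K)"
  define X where "X = {x, y, (s, 1), (t, 2)}"
  have f_low: "?f 1 u = 2 * ?K - r u" "?f 2 u = r u" if "u \<in> low k" for u
    using that by (auto simp: low_def r_def pval_def extremal_system_A[of k, OF pos])
  have f_s: "?f 1 (s, 1) = 2 * ?K - r x" "?f 2 (s, 1) = 2 * ?K - r x"
    and f_t: "?f 1 (t, 2) = r y + 3 * ?K" "?f 2 (t, 2) = r y"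
    using r_bd[OF low_xy(1)] r_bd[OF low_xy(2)]
    by (auto simp: s_def t_def pval_high extremal_system_A[of k, OF pos] top_value_def)
  note vals = f_low[OF low_xy(1)] f_low[OF low_xy(2)] f_s f_t
    r_bd[OF low_xy(1)] r_bd[OF low_xy(2)]
  have ryx: "r y \<le> r x" using x y by auto
  have high: "(s, 1) \<notin> low k" "(t, 2) \<notin> low k" by (auto simp: low_def s_def t_def)
  then have hneq: "(s, 1) \<noteq> x" "(t, 2) \<noteq> y" using low_xy by metis+
  have "tie (?f 1) X x (s, 1)" "tie (?f 2) X y (t, 2)"
    using vals ryx hneq by (auto simp: tie_def X_def)
  then have sol: "point_solution k (extremal_system k) X"
    unfolding point_solution_2 by blast
  have least1: "z = x \<or> z = (s, 1)" if "z \<in> X" "?f 1 z \<le> ?f 1 (s, 1)" for z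
    using that vals ryx r_inj[OF low_xy(2,1)] unfolding X_def by auto
  have least2: "z = y \<or> z = (t, 2)" if "z \<in> X" "?f 2 z \<le> ?f 2 (t, 2)" for z
    using that vals ryx r_inj[OF low_xy] unfolding X_def by auto
  \<comment> \<open>A solution inside \<open>X\<close> contains both high points, as it meets all classes; by the two facts
    above, their tie partners are then forced.\<close>
  have "Y = X" if Y: "Y \<subseteq> X" "point_solution k (extremal_system k) Y" for Y
  proof -
    obtain a b c d where t1: "tie (?f 1) Y a b" and t2: "tie (?f 2) Y c d"
      using Y(2) unfolding point_solution_2 by blast
    have "{a, b, c, d} \<subseteq> Y" using t1 t2 by (auto simp: tie_def)
    then have meet: "\<exists>z\<in>Y. point_class k z = Some j" for j
      using ties_meet_class[OF extremal_system_generic[of k, OF pos]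
          extremal_system_regular[of k, OF pos] t1 t2, of "Some j"] by blast
    obtain u where u: "u \<in> Y" "point_class k u = Some 1" using meet[of 1] by blast
    obtain v where v: "v \<in> Y" "point_class k v = Some 2" using meet[of 2] by blast
    have not_low: "u \<notin> low k" "v \<notin> low k" using u v by (simp_all flip: point_class_None)
    have "snd u = 1" "snd v = 2" using u v by (simp_all add: point_class_Some)
    then have other: "u \<noteq> (t, 2)" "v \<noteq> (s, 1)" using one_neq_two by (metis snd_conv)+
    have "u \<in> {x, y, (s, 1), (t, 2)}" "v \<in> {x, y, (s, 1), (t, 2)}"
      using u(1) v(1) Y(1) unfolding X_def by blast+
    then have "u = (s, 1)" "v = (t, 2)" using not_low low_xy other by blast+
    then have st: "(s, 1) \<in> Y" "(t, 2) \<in> Y" using u(1) v(1) by simp_all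
    then have ab_cd: "?f 1 a \<le> ?f 1 (s, 1)" "?f 1 b \<le> ?f 1 (s, 1)" "a \<in> Y" "b \<in> Y" "a \<noteq> b"
      "?f 2 c \<le> ?f 2 (t, 2)" "?f 2 d \<le> ?f 2 (t, 2)" "c \<in> Y" "d \<in> Y" "c \<noteq> d"
      using t1 t2 unfolding tie_def by metis+
    have "{a, b, c, d} \<subseteq> X" using ab_cd Y(1) by blast
    then have "x \<in> {a, b}" "y \<in> {c, d}"
      using least1[of a] least1[of b] least2[of c] least2[of d] ab_cd by blast+
    then have "x \<in> Y" "y \<in> Y" using ab_cd by blast+
    then show "Y = X" using st Y(1) unfolding X_def by blast
  qed
  then have "minimal_points k (extremal_system k) X"
    using sol by (auto simp: minimal_points_def)
  moreover have "X \<inter> low k = L" using low_xy high Lxy unfolding X_def by auto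
  ultimately show ?thesis by blast
qed

section \<open>The maximal number of minimal solutions\<close>

theorem corollary4p11:
  fixes k :: "2 \<Rightarrow> nat"
  assumes "\<And>j. k j > 0"
  shows "(\<forall>\<Sigma>. regular_system k \<Sigma> \<and> generic_system k \<Sigma> \<longrightarrow>
            finite {S. minimal_solution k \<Sigma> S} \<and>
            card {S. minimal_solution k \<Sigma> S} \<le> (k 1 + k 2) * (k 1 + k 2 + 1) div 2) \<and>
         (\<exists>\<Sigma>. regular_system k \<Sigma> \<and> generic_system k \<Sigma> \<and>
            finite {S. minimal_solution k \<Sigma> S} \<and>
            card {S. minimal_solution k \<Sigma> S} = (k 1 + k 2) * (k 1 + k 2 + 1) div 2)"
proof -
  let ?low = "\<lambda>X. X \<inter> low k"
  have bound: "finite {S. minimal_solution k \<Sigma> S} \<and>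
      card {S. minimal_solution k \<Sigma> S} = card (?low ` {X. minimal_points k \<Sigma> X}) \<and>
      ?low ` {X. minimal_points k \<Sigma> X} \<subseteq> pair_family k"
    if reg: "regular_system k \<Sigma>" and gen: "generic_system k \<Sigma>" for \<Sigma>
  proof -
    note sub = minimal_points_low_in_pair_family[OF gen reg]
    note inj = minimal_points_inj[OF gen reg]
    have "finite {X. minimal_points k \<Sigma> X}"
      using finite_imageD[OF finite_subset[OF sub card_pair_family(1)] inj] .
    then show ?thesis
      using bij_betw_finite[OF minimal_solutions_bij[OF reg]]
        bij_betw_same_card[OF minimal_solutions_bij[OF reg]] card_image[OF inj] sub
      by (simp only: simp_thms)
  qed
  show ?thesis
  proof (intro conjI allI impI)
    fix \<Sigma> assume "regular_system k \<Sigma> \<and> generic_system k \<Sigma>"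
    then have b: "finite {S. minimal_solution k \<Sigma> S}"
        "card {S. minimal_solution k \<Sigma> S} = card (?low ` {X. minimal_points k \<Sigma> X})"
        "?low ` {X. minimal_points k \<Sigma> X} \<subseteq> pair_family k"
      using bound[of \<Sigma>] by simp_all
    show "finite {S. minimal_solution k \<Sigma> S}" by (rule b(1))
    show "card {S. minimal_solution k \<Sigma> S} \<le> (k 1 + k 2) * (k 1 + k 2 + 1) div 2"
      using card_mono[OF card_pair_family(1) b(3)] b(2) card_pair_family(2)[of k] by simp
  next
    let ?E = "extremal_system k"
    have rg: "regular_system k ?E" "generic_system k ?E"
      using extremal_system_regular extremal_system_generic assms by blast+
    have "?low ` {X. minimal_points k ?E X} = pair_family k"
    proof
      show "?low ` {X. minimal_points k ?E X} \<subseteq> pair_family k" using bound[OF rg] by simp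
      show "pair_family k \<subseteq> ?low ` {X. minimal_points k ?E X}"
      proof
        fix L assume "L \<in> pair_family k"
        then obtain X where "minimal_points k ?E X" "X \<inter> low k = L"
          using extremal_system_minimal_points[of k, OF assms] by metis
        then show "L \<in> ?low ` {X. minimal_points k ?E X}" by auto
      qed
    qed
    then have "card {S. minimal_solution k ?E S} = (k 1 + k 2) * (k 1 + k 2 + 1) div 2"
      using bound[OF rg] card_pair_family(2)[of k] by simp
    then show "\<exists>\<Sigma>. regular_system k \<Sigma> \<and> generic_system k \<Sigma> \<and>
        finite {S. minimal_solution k \<Sigma> S} \<and>
        card {S. minimal_solution k \<Sigma> S} = (k 1 + k 2) * (k 1 + k 2 + 1) div 2"
      using rg bound[OF rg] by blast
  qed
qed


end
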